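(* Let $\mathcal{H}$ be a real Hilbert space, let $\gamma\in[0,1[$ and let $G:\mathcal{H}\to\mathcal{H}$ be a $\gamma$-BAM. Then for every $k\in\mathbb{N}=\{0,1,2,\ldots\}$: (i) $\mathrm{P}_{\operatorname{Fix}G}G^k=\mathrm{P}_{\operatorname{Fix}G}$, and (ii) $(\forall x\in\mathcal{H})$ $\|G^kx-\mathrm{P}_{\operatorname{Fix}G}x\|\le\gamma^k\|x-\mathrm{P}_{\operatorname{Fix}G}x\|$. Consequently, for every $x\in\mathcal{H}$, $(G^kx)_{k\in\mathbb{N}}$ converges to $\mathrm{P}_{\operatorname{Fix}G}x$ with a linear rate $\gamma$.
   Context: For a nonempty closed convex set $C\subseteq\mathcal{H}$, $\mathrm{P}_C$ denotes the metric projection onto $C$. $\operatorname{Fix}G=\{x\in\mathcal{H}: Gx=x\}$. $G^k$ is the $k$-fold composition of $G$ with itself ($G^0=\mathrm{Id}$), and the convention $\gamma^0=1$ is used. Definition (BAM). Let $G:\mathcal{H}\to\mathcal{H}$ and $\gamma\in[0,1[$. $G$ is a best approximation mapping with constant $\gamma$ ($\gamma$-BAM) if (1) $\operatorname{Fix}G$ is a nonempty closed convex subset of $\mathcal{H}$; (2) $\mathrm{P}_{\operatorname{Fix}G}G=\mathrm{P}_{\operatorname{Fix}G}$; (3) $\|Gx-\mathrm{P}_{\operatorname{Fix}G}x\|\le\gamma\|x-\mathrm{P}_{\operatorname{Fix}G}x\|$ for all $x\in\mathcal{H}$. "Linear rate $\gamma$" means the estimate in (ii). *)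

theory Defs
  imports "HOL-Analysis.Analysis"
begin

definition Fix :: "('a \<Rightarrow> 'a) \<Rightarrow> 'a set" where
  "Fix G = {x. G x = x}"

(* Same notion as closest_point from HOL-Analysis, whose sort constraint heine_borel
   would restrict it to finite-dimensional spaces. In a Hilbert space the minimizer exists and is
   unique for nonempty closed convex C; nothing is claimed about other C. *)
definition metric_proj :: "'a::metric_space set \<Rightarrow> 'a \<Rightarrow> 'a" where
  "metric_proj C x = (THE p. p \<in> C \<and> (\<forall>y\<in>C. dist x p \<le> dist x y))"

definition BAM :: "real \<Rightarrow> ('a::real_inner \<Rightarrow> 'a) \<Rightarrow> bool" where
  "BAM \<gamma> G \<longleftrightarrow>
     0 \<le> \<gamma> \<and> \<gamma> < 1 \<and>
     Fix G \<noteq> {} \<and> closed (Fix G) \<and> convex (Fix G) \<and>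
     metric_proj (Fix G) \<circ> G = metric_proj (Fix G) \<and>
     (\<forall>x. norm (G x - metric_proj (Fix G) x) \<le> \<gamma> * norm (x - metric_proj (Fix G) x))"

end

theory Submission
  imports Defs
begin

text \<open>Since applying \<open>G\<close> does not change the projection onto
  \<open>Fix G\<close>, all iterates of \<open>x\<close> share one projection p
  (\<open>metric_proj_funpow\<close>). The BAM inequality at each iterate therefore measures the
  distance to the same point p, and every application of \<open>G\<close> shrinks that distance by
  the factor \<gamma>. Induction gives the geometric bound
  (\<open>norm_funpow_diff_metric_proj_le\<close>), and \<gamma> < 1 turns it into
  convergence.\<close>

lemma metric_proj_funpow:
  assumes "BAM \<gamma> G"
  shows "metric_proj (Fix G) ((G ^^ k) x) = metric_proj (Fix G) x"
proof (induction k)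
  case 0
  show ?case by simp
next
  case (Suc k)
  have "metric_proj (Fix G) (G y) = metric_proj (Fix G) y" for y
    using assms unfolding BAM_def by (metis comp_apply)
  with Suc show ?case by simp
qed

lemma norm_funpow_diff_metric_proj_le:
  assumes "BAM \<gamma> G"
  shows "norm ((G ^^ k) x - metric_proj (Fix G) x) \<le> \<gamma> ^ k * norm (x - metric_proj (Fix G) x)"
proof (induction k)
  case 0
  show ?case by simp
next
  case (Suc k)
  let ?p = "metric_proj (Fix G) x" and ?y = "(G ^^ k) x"
  have \<gamma>: "0 \<le> \<gamma>"
    and step: "norm (G ?y - metric_proj (Fix G) ?y) \<le> \<gamma> * norm (?y - metric_proj (Fix G) ?y)"
    using assms by (simp_all add: BAM_def)
  have "norm ((G ^^ Suc k) x - ?p) \<le> \<gamma> * norm (?y - ?p)"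
    \<comment> \<open>The inequality \<open>step\<close> is centred at the projection of
      \<open>?y\<close>; invariance along the orbit identifies that centre with
      \<open>?p\<close>.\<close>
    using step by (simp add: metric_proj_funpow[OF assms])
  also have "\<dots> \<le> \<gamma> * (\<gamma> ^ k * norm (x - ?p))"
    using Suc \<gamma> by (rule mult_left_mono)
  finally show ?case by (simp add: mult.assoc)
qed

text \<open>The error is squeezed by a geometric sequence times the constant initial
  distance.\<close>

lemma funpow_tendsto_metric_proj:
  assumes "BAM \<gamma> G"
  shows "(\<lambda>k. (G ^^ k) x) \<longlonglongrightarrow> metric_proj (Fix G) x"
proof -
  have "(\<lambda>k. \<gamma> ^ k) \<longlonglongrightarrow> 0"
    \<comment> \<open>The side condition is \<open>norm \<gamma> < 1\<close>, which follows from 0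
      \<le> \<gamma> < 1.\<close>
    using assms by (intro LIMSEQ_power_zero) (simp add: BAM_def)
  then have "(\<lambda>k. \<gamma> ^ k * norm (x - metric_proj (Fix G) x)) \<longlonglongrightarrow> 0"
    by (rule tendsto_mult_left_zero)
  then have "(\<lambda>k. (G ^^ k) x - metric_proj (Fix G) x) \<longlonglongrightarrow> 0"
    by (rule Lim_null_comparison[rotated])
      (simp add: norm_funpow_diff_metric_proj_le[OF assms])
  then show ?thesis by (simp add: LIM_zero_iff)
qed

theorem proposition3p10:
  fixes G :: "'a::{real_inner, complete_space} \<Rightarrow> 'a" and \<gamma> :: real
  assumes "0 \<le> \<gamma>" and "\<gamma> < 1" and "BAM \<gamma> G"
  shows "(\<forall>k::nat.
            metric_proj (Fix G) \<circ> (G ^^ k) = metric_proj (Fix G) \<and>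
            (\<forall>x. norm ((G ^^ k) x - metric_proj (Fix G) x)
                   \<le> \<gamma> ^ k * norm (x - metric_proj (Fix G) x))) \<and>
         (\<forall>x. (\<lambda>k. (G ^^ k) x) \<longlonglongrightarrow> metric_proj (Fix G) x \<and>
              (\<forall>k. norm ((G ^^ k) x - metric_proj (Fix G) x)
                     \<le> \<gamma> ^ k * norm (x - metric_proj (Fix G) x)))"
  \<comment> \<open>Linear rate \<gamma> means the estimate in (ii), so the same lemma settles both
    occurrences of the bound.\<close>
  using assms(3)
  by (auto simp: fun_eq_iff metric_proj_funpow
      intro: norm_funpow_diff_metric_proj_le funpow_tendsto_metric_proj)

end
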